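(* There is a formula $\phi(x,y)$ of $\mathsf{InqBT}$ in the empty vocabulary (only identity), with free variables $x,y$, for which there is no first-order sentence $\phi^*(R)$ over the vocabulary $\{R\}$, $R$ a binary relation symbol, such that for all models $\mathcal{M}$ and all teams $X$ with domain $\{x,y\}$: $\mathcal{M}\models_X\phi(x,y)$ iff $(\mathcal{M},X[x,y])\models\phi^*(R)$.
   Context: Syntax of $\mathsf{InqBT}$: $\phi ::= p \mid \bot \mid (\phi\wedge\phi)\mid(\phi\veebar\phi)\mid(\phi\to\phi)\mid\forall x\phi\mid\exists^{\mathrm{i}}x\phi$, with $p$ first-order atoms. Models $\mathcal{M}=(D,I)$ are ordinary first-order structures; a team $X$ is a set of assignments with a common variable domain; $X[x\mapsto d]=\{g[x\mapsto d]: g\in X\}$. Support $\mathcal{M}\models_X\phi$: atoms iff true under every $g\in X$; $\bot$ iff $X=\emptyset$; $\wedge$ conjunction; $\phi\veebar\psi$ iff $\phi$ or $\psi$ supported; $\phi\to\psi$ iff every $Y\subseteq X$ supporting $\phi$ supports $\psi$; $\forall x\phi$ iff $X[x\mapsto d]$ supports $\phi$ for all $d\in D$; $\exists^{\mathrm{i}}x\phi$ iff $X[x\mapsto d]$ supports $\phi$ for some $d\in D$. For a team $X$ with $x,y\in\mathrm{dom}(X)$, $X[x,y]=\{(g(x),g(y)): g\in X\}\subseteq D^2$, and $(\mathcal{M},X[x,y])$ is the expansion of $\mathcal{M}$ interpreting $R$ as $X[x,y]$. *)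

theory Defs
  imports Main
begin

(* Symbols carry no intrinsic arity: a vocabulary lists its function and relation symbols as
   pairs (symbol, arity), and an occurrence is classified by its number of arguments. *)
record ('f, 'r) vocabulary =
  funs :: "('f \<times> nat) set"
  rels :: "('r \<times> nat) set"

definition empty_voc :: "('f, 'r) vocabulary" where
  "empty_voc = \<lparr>funs = {}, rels = {}\<rparr>"

definition binary_voc :: "'r \<Rightarrow> ('f, 'r) vocabulary" where
  "binary_voc R = \<lparr>funs = {}, rels = {(R, 2)}\<rparr>"

type_synonym var = nat

datatype 'f trm = Var var | Fn 'f "'f trm list"

datatype ('f, 'r) atom = Eq "'f trm" "'f trm" | Rel 'r "'f trm list"

fun trm_vars :: "'f trm \<Rightarrow> var set" where
  "trm_vars (Var v) = {v}"
| "trm_vars (Fn f ts) = (\<Union>t\<in>set ts. trm_vars t)"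

fun atom_vars :: "('f, 'r) atom \<Rightarrow> var set" where
  "atom_vars (Eq s t) = trm_vars s \<union> trm_vars t"
| "atom_vars (Rel r ts) = (\<Union>t\<in>set ts. trm_vars t)"

fun trm_over :: "('f, 'r) vocabulary \<Rightarrow> 'f trm \<Rightarrow> bool" where
  "trm_over V (Var v) \<longleftrightarrow> True"
| "trm_over V (Fn f ts) \<longleftrightarrow> (f, length ts) \<in> funs V \<and> (\<forall>t\<in>set ts. trm_over V t)"

fun atom_over :: "('f, 'r) vocabulary \<Rightarrow> ('f, 'r) atom \<Rightarrow> bool" where
  "atom_over V (Eq s t) \<longleftrightarrow> trm_over V s \<and> trm_over V t"
| "atom_over V (Rel r ts) \<longleftrightarrow> (r, length ts) \<in> rels V \<and> (\<forall>t\<in>set ts. trm_over V t)"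

record ('f, 'r, 'u) struct =
  universe :: "'u set"
  fun_interp :: "'f \<Rightarrow> 'u list \<Rightarrow> 'u"
  rel_interp :: "'r \<Rightarrow> 'u list set"

(* The interpretation of symbols outside the vocabulary is unconstrained and irrelevant. *)
definition structure_over :: "('f, 'r) vocabulary \<Rightarrow> ('f, 'r, 'u) struct \<Rightarrow> bool" where
  "structure_over V M \<longleftrightarrow> universe M \<noteq> {} \<and>
     (\<forall>(f, n)\<in>funs V. \<forall>us. length us = n \<and> set us \<subseteq> universe M \<longrightarrow> fun_interp M f us \<in> universe M) \<and>
     (\<forall>(r, n)\<in>rels V. \<forall>us\<in>rel_interp M r. length us = n \<longrightarrow> set us \<subseteq> universe M)"

definition expand_binary :: "('f, 'r, 'u) struct \<Rightarrow> 'r \<Rightarrow> ('u \<times> 'u) set \<Rightarrow> ('f, 'r, 'u) struct" where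
  "expand_binary M R S = M\<lparr>rel_interp := (rel_interp M)(R := {[a, b] | a b. (a, b) \<in> S})\<rparr>"

(* Assignments are partial maps, so that the variable domain of an assignment is part of it. *)
type_synonym 'u assignment = "var \<Rightarrow> 'u option"

primrec trm_value :: "('f, 'r, 'u) struct \<Rightarrow> 'u assignment \<Rightarrow> 'f trm \<Rightarrow> 'u" where
  "trm_value M g (Var v) = the (g v)"
| "trm_value M g (Fn f ts) = fun_interp M f (map (trm_value M g) ts)"

fun atom_true :: "('f, 'r, 'u) struct \<Rightarrow> 'u assignment \<Rightarrow> ('f, 'r) atom \<Rightarrow> bool" where
  "atom_true M g (Eq s t) \<longleftrightarrow> trm_value M g s = trm_value M g t"
| "atom_true M g (Rel r ts) \<longleftrightarrow> map (trm_value M g) ts \<in> rel_interp M r"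

datatype ('f, 'r) fo =
    FAtom "('f, 'r) atom"
  | FBot
  | FAnd "('f, 'r) fo" "('f, 'r) fo"
  | FOr "('f, 'r) fo" "('f, 'r) fo"
  | FImp "('f, 'r) fo" "('f, 'r) fo"
  | FAll var "('f, 'r) fo"
  | FEx var "('f, 'r) fo"

primrec fo_over :: "('f, 'r) vocabulary \<Rightarrow> ('f, 'r) fo \<Rightarrow> bool" where
  "fo_over V (FAtom p) \<longleftrightarrow> atom_over V p"
| "fo_over V FBot \<longleftrightarrow> True"
| "fo_over V (FAnd \<phi> \<psi>) \<longleftrightarrow> fo_over V \<phi> \<and> fo_over V \<psi>"
| "fo_over V (FOr \<phi> \<psi>) \<longleftrightarrow> fo_over V \<phi> \<and> fo_over V \<psi>"
| "fo_over V (FImp \<phi> \<psi>) \<longleftrightarrow> fo_over V \<phi> \<and> fo_over V \<psi>"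
| "fo_over V (FAll v \<phi>) \<longleftrightarrow> fo_over V \<phi>"
| "fo_over V (FEx v \<phi>) \<longleftrightarrow> fo_over V \<phi>"

primrec fo_free :: "('f, 'r) fo \<Rightarrow> var set" where
  "fo_free (FAtom p) = atom_vars p"
| "fo_free FBot = {}"
| "fo_free (FAnd \<phi> \<psi>) = fo_free \<phi> \<union> fo_free \<psi>"
| "fo_free (FOr \<phi> \<psi>) = fo_free \<phi> \<union> fo_free \<psi>"
| "fo_free (FImp \<phi> \<psi>) = fo_free \<phi> \<union> fo_free \<psi>"
| "fo_free (FAll v \<phi>) = fo_free \<phi> - {v}"
| "fo_free (FEx v \<phi>) = fo_free \<phi> - {v}"

definition fo_sentence :: "('f, 'r) fo \<Rightarrow> bool" where
  "fo_sentence \<phi> \<longleftrightarrow> fo_free \<phi> = {}"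

primrec fo_sat :: "('f, 'r, 'u) struct \<Rightarrow> ('f, 'r) fo \<Rightarrow> 'u assignment \<Rightarrow> bool" where
  "fo_sat M (FAtom p) g \<longleftrightarrow> atom_true M g p"
| "fo_sat M FBot g \<longleftrightarrow> False"
| "fo_sat M (FAnd \<phi> \<psi>) g \<longleftrightarrow> fo_sat M \<phi> g \<and> fo_sat M \<psi> g"
| "fo_sat M (FOr \<phi> \<psi>) g \<longleftrightarrow> fo_sat M \<phi> g \<or> fo_sat M \<psi> g"
| "fo_sat M (FImp \<phi> \<psi>) g \<longleftrightarrow> (fo_sat M \<phi> g \<longrightarrow> fo_sat M \<psi> g)"
| "fo_sat M (FAll v \<phi>) g \<longleftrightarrow> (\<forall>d\<in>universe M. fo_sat M \<phi> (g(v \<mapsto> d)))"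
| "fo_sat M (FEx v \<phi>) g \<longleftrightarrow> (\<exists>d\<in>universe M. fo_sat M \<phi> (g(v \<mapsto> d)))"

definition fo_true :: "('f, 'r, 'u) struct \<Rightarrow> ('f, 'r) fo \<Rightarrow> bool" where
  "fo_true M \<phi> \<longleftrightarrow> fo_sat M \<phi> Map.empty"

(* IOr is inquisitive disjunction, IEx the inquisitive existential quantifier. *)
datatype ('f, 'r) inqbt =
    IAtom "('f, 'r) atom"
  | IBot
  | IAnd "('f, 'r) inqbt" "('f, 'r) inqbt"
  | IOr "('f, 'r) inqbt" "('f, 'r) inqbt"
  | IImp "('f, 'r) inqbt" "('f, 'r) inqbt"
  | IAll var "('f, 'r) inqbt"
  | IEx var "('f, 'r) inqbt"

primrec inqbt_over :: "('f, 'r) vocabulary \<Rightarrow> ('f, 'r) inqbt \<Rightarrow> bool" where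
  "inqbt_over V (IAtom p) \<longleftrightarrow> atom_over V p"
| "inqbt_over V IBot \<longleftrightarrow> True"
| "inqbt_over V (IAnd \<phi> \<psi>) \<longleftrightarrow> inqbt_over V \<phi> \<and> inqbt_over V \<psi>"
| "inqbt_over V (IOr \<phi> \<psi>) \<longleftrightarrow> inqbt_over V \<phi> \<and> inqbt_over V \<psi>"
| "inqbt_over V (IImp \<phi> \<psi>) \<longleftrightarrow> inqbt_over V \<phi> \<and> inqbt_over V \<psi>"
| "inqbt_over V (IAll v \<phi>) \<longleftrightarrow> inqbt_over V \<phi>"
| "inqbt_over V (IEx v \<phi>) \<longleftrightarrow> inqbt_over V \<phi>"

primrec inqbt_free :: "('f, 'r) inqbt \<Rightarrow> var set" where
  "inqbt_free (IAtom p) = atom_vars p"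
| "inqbt_free IBot = {}"
| "inqbt_free (IAnd \<phi> \<psi>) = inqbt_free \<phi> \<union> inqbt_free \<psi>"
| "inqbt_free (IOr \<phi> \<psi>) = inqbt_free \<phi> \<union> inqbt_free \<psi>"
| "inqbt_free (IImp \<phi> \<psi>) = inqbt_free \<phi> \<union> inqbt_free \<psi>"
| "inqbt_free (IAll v \<phi>) = inqbt_free \<phi> - {v}"
| "inqbt_free (IEx v \<phi>) = inqbt_free \<phi> - {v}"

type_synonym 'u team = "'u assignment set"

definition team_on :: "('f, 'r, 'u) struct \<Rightarrow> var set \<Rightarrow> 'u team \<Rightarrow> bool" where
  "team_on M W X \<longleftrightarrow> (\<forall>g\<in>X. dom g = W \<and> ran g \<subseteq> universe M)"

definition team_upd :: "'u team \<Rightarrow> var \<Rightarrow> 'u \<Rightarrow> 'u team" where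
  "team_upd X v d = {g(v \<mapsto> d) | g. g \<in> X}"

definition team_rel :: "'u team \<Rightarrow> var \<Rightarrow> var \<Rightarrow> ('u \<times> 'u) set" where
  "team_rel X x y = {(the (g x), the (g y)) | g. g \<in> X}"

primrec supports :: "('f, 'r, 'u) struct \<Rightarrow> ('f, 'r) inqbt \<Rightarrow> 'u team \<Rightarrow> bool" where
  "supports M (IAtom p) X \<longleftrightarrow> (\<forall>g\<in>X. atom_true M g p)"
| "supports M IBot X \<longleftrightarrow> X = {}"
| "supports M (IAnd \<phi> \<psi>) X \<longleftrightarrow> supports M \<phi> X \<and> supports M \<psi> X"
| "supports M (IOr \<phi> \<psi>) X \<longleftrightarrow> supports M \<phi> X \<or> supports M \<psi> X"
| "supports M (IImp \<phi> \<psi>) X \<longleftrightarrow> (\<forall>Y. Y \<subseteq> X \<longrightarrow> supports M \<phi> Y \<longrightarrow> supports M \<psi> Y)"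
| "supports M (IAll v \<phi>) X \<longleftrightarrow> (\<forall>d\<in>universe M. supports M \<phi> (team_upd X v d))"
| "supports M (IEx v \<phi>) X \<longleftrightarrow> (\<exists>d\<in>universe M. supports M \<phi> (team_upd X v d))"

end

theory Submission
  imports Defs
begin

text \<open>
  Let \<open>\<phi>\<close> say that no subteam in which \<open>y\<close> determines \<open>x\<close> lets \<open>x\<close> range over the whole domain
  \<open>D\<close>. On the team of all pairs in \<open>D \<times> (D - {c})\<close> this says that no subset of \<open>D - {c}\<close> maps onto
  \<open>D\<close>, i.e. that \<open>D\<close> is finite. The relation \<open>D \<times> (D - {c})\<close> only marks the point \<open>c\<close>, and an
  Ehrenfeucht-Fraisse argument shows that a first-order sentence cannot tell a sufficiently large
  finite set with a marked point from an infinite one.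
\<close>

section \<open>Building blocks of the formula and their support conditions\<close>

definition const_inq :: "var \<Rightarrow> var \<Rightarrow> ('f, 'r) inqbt" where
  "const_inq z v = IEx z (IAtom (Eq (Var z) (Var v)))"

text \<open>\<open>IEx\<close> picks one value for the whole team, so \<open>const_inq z v\<close>
  expresses constancy of \<open>v\<close>. Since implication ranges over all subteams, an
  implication between two constancies is the dependence atom: \<open>v\<close> determines
  \<open>w\<close>.\<close>

definition dep_inq :: "var \<Rightarrow> var \<Rightarrow> var \<Rightarrow> ('f, 'r) inqbt" where
  "dep_inq z v w = IImp (const_inq z v) (const_inq z w)"

definition misses_inq :: "var \<Rightarrow> var \<Rightarrow> ('f, 'r) inqbt" where
  "misses_inq z v = IEx z (IImp (IAtom (Eq (Var z) (Var v))) IBot)"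

lemma ball_team_upd: "(\<forall>g\<in>team_upd X v d. P g) \<longleftrightarrow> (\<forall>g\<in>X. P (g(v \<mapsto> d)))"
  by (auto simp: team_upd_def)

lemma supports_const_inq:
  assumes "z \<noteq> v"
  shows "supports M (const_inq z v) X \<longleftrightarrow> (\<exists>d\<in>universe M. \<forall>g\<in>X. d = the (g v))"
  using assms by (simp add: const_inq_def ball_team_upd)

text \<open>Functional dependence concerns only pairs of assignments, so the two-element subteams
  \<open>{g, h}\<close> already give one direction. Conversely, on a subteam where \<open>v\<close>
  is constant, any member supplies the common value of \<open>w\<close>.\<close>

lemma supports_dep_inq:
  assumes "z \<noteq> v" "z \<noteq> w" "universe M \<noteq> {}"
    and "\<And>g. g \<in> X \<Longrightarrow> the (g v) \<in> universe M" "\<And>g. g \<in> X \<Longrightarrow> the (g w) \<in> universe M"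
  shows "supports M (dep_inq z v w) X \<longleftrightarrow>
    (\<forall>g\<in>X. \<forall>h\<in>X. the (g v) = the (h v) \<longrightarrow> the (g w) = the (h w))"
    (is "?L \<longleftrightarrow> ?R")
proof
  assume L: ?L
  show ?R
  proof (intro ballI impI)
    fix g h assume gh: "g \<in> X" "h \<in> X" "the (g v) = the (h v)"
    have "supports M (const_inq z v) {g, h}"
      using gh assms by (auto simp: supports_const_inq)
    then have "supports M (const_inq z w) {g, h}"
      using L gh by (simp add: dep_inq_def)
    then show "the (g w) = the (h w)"
      using assms by (auto simp: supports_const_inq)
  qed
next
  assume R: ?R
  have "\<exists>e\<in>universe M. \<forall>g\<in>Y. e = the (g w)"
    if "Y \<subseteq> X" and d: "\<forall>g\<in>Y. d = the (g v)" for Y d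
  proof (cases "Y = {}")
    \<comment> \<open>Even over the empty subteam the quantifier asks for a witness; this is where
      nonemptiness of the universe enters.\<close>
    case True
    then show ?thesis using assms(3) by auto
  next
    case False
    then obtain h where "h \<in> Y" by blast
    have "the (h w) = the (g w)" if "g \<in> Y" for g
    proof -
      have "the (h v) = the (g v)" using d \<open>h \<in> Y\<close> that by metis
      then show ?thesis using R \<open>Y \<subseteq> X\<close> \<open>h \<in> Y\<close> that by blast
    qed
    moreover have "the (h w) \<in> universe M" using \<open>h \<in> Y\<close> \<open>Y \<subseteq> X\<close> assms(5) by blast
    ultimately show ?thesis by blast
  qed
  then show ?L
    using assms(1,2) by (simp add: dep_inq_def supports_const_inq) blast
qed

text \<open>Implication into \<open>IBot\<close> excludes every nonempty subteam satisfying the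
  equation, and testing singletons suffices; the negated equation therefore holds assignment by
  assignment for one common \<open>d\<close>.\<close>

lemma supports_misses_inq:
  assumes "z \<noteq> v"
  shows "supports M (misses_inq z v) X \<longleftrightarrow> (\<exists>d\<in>universe M. \<forall>g\<in>X. the (g v) \<noteq> d)"
proof -
  have "(\<forall>Y\<subseteq>team_upd X z d. (\<forall>g\<in>Y. the (g z) = the (g v)) \<longrightarrow> Y = {}) \<longleftrightarrow>
      (\<forall>g\<in>X. the (g v) \<noteq> d)" (is "?L \<longleftrightarrow> ?R") for d
  proof
    assume L: ?L
    show ?R
    proof
      fix g assume "g \<in> X"
      then have "{g(z \<mapsto> d)} \<subseteq> team_upd X z d" by (auto simp: team_upd_def)
      with L have "\<not> (\<forall>g'\<in>{g(z \<mapsto> d)}. the (g' z) = the (g' v))" by blast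
      then show "the (g v) \<noteq> d" using assms by auto
    qed
  next
    assume R: ?R
    have "the (g z) \<noteq> the (g v)" if "g \<in> team_upd X z d" for g
      using that R assms by (auto simp: team_upd_def)
    then show ?L by blast
  qed
  then show ?thesis by (simp add: misses_inq_def)
qed

section \<open>Finiteness of the universe expressed on teams of pairs\<close>

definition no_cover_inq :: "var \<Rightarrow> var \<Rightarrow> var \<Rightarrow> ('f, 'r) inqbt" where
  "no_cover_inq z x y = IImp (dep_inq z y x) (misses_inq z x)"

definition pair_team :: "var \<Rightarrow> var \<Rightarrow> ('u \<times> 'u) set \<Rightarrow> 'u team" where
  "pair_team x y S = (\<lambda>(a, b). [x \<mapsto> a, y \<mapsto> b]) ` S"

lemma team_rel_pair_team:
  assumes "x \<noteq> y"
  shows "team_rel (pair_team x y S) x y = S"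
proof -
  have "team_rel (pair_team x y S) x y =
      (\<lambda>g. (the (g x), the (g y))) ` (\<lambda>(a, b). [x \<mapsto> a, y \<mapsto> b]) ` S"
    by (auto simp: team_rel_def pair_team_def)
  also have "\<dots> = S"
    using assms by (simp add: image_image case_prod_unfold)
  finally show ?thesis .
qed

lemma team_on_pair_team:
  assumes "x \<noteq> y" "S \<subseteq> universe M \<times> universe M"
  shows "team_on M {x, y} (pair_team x y S)"
  using assms by (auto simp: team_on_def pair_team_def ran_def split: if_splits)

text \<open>Subteams in which \<open>y\<close> determines \<open>x\<close> are the graphs of partial
  functions from the universe without \<open>c\<close> into the universe. One of them is onto
  exactly when the universe injects into itself minus a point, that is, when it is Dedekind
  infinite.\<close>

lemma supports_no_cover_inq_iff_finite:
  assumes "z \<noteq> x" "z \<noteq> y" "x \<noteq> y" and c: "c \<in> universe M"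
  shows "supports M (no_cover_inq z x y) (pair_team x y (universe M \<times> (universe M - {c})))
    \<longleftrightarrow> finite (universe M)"
proof -
  let ?A = "universe M" and ?X = "pair_team x y (universe M \<times> (universe M - {c}))"
  have val: "the (g x) \<in> ?A" "the (g y) \<in> ?A - {c}" if "g \<in> ?X" for g
    using that \<open>x \<noteq> y\<close> by (auto simp: pair_team_def)
  have dep: "supports M (dep_inq z y x) Y \<longleftrightarrow>
      (\<forall>g\<in>Y. \<forall>h\<in>Y. the (g y) = the (h y) \<longrightarrow> the (g x) = the (h x))" if "Y \<subseteq> ?X" for Y
    by (rule supports_dep_inq[OF assms(2,1)]) (use c val[OF subsetD[OF that]] in auto)
  show ?thesis
  proof
    assume sup: "supports M (no_cover_inq z x y) ?X"
    show "finite ?A"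
    proof (rule ccontr)
      assume "infinite ?A"
      then obtain f where f: "bij_betw f ?A (?A - {c})"
        using infinite_imp_bij_betw[of ?A c] by blast
      \<comment> \<open>The graph of the inverse of \<open>f\<close>: injectivity of
        \<open>f\<close> makes \<open>y\<close> determine \<open>x\<close>, while \<open>x\<close>
        runs through the whole universe.\<close>
      let ?Y = "pair_team x y ((\<lambda>a. (a, f a)) ` ?A)"
      have Y: "?Y \<subseteq> ?X"
        unfolding pair_team_def using bij_betwE[OF f] by (intro image_mono) auto
      have "supports M (dep_inq z y x) ?Y"
        unfolding dep[OF Y] using inj_onD[OF bij_betw_imp_inj_on[OF f]] \<open>x \<noteq> y\<close>
        by (simp add: pair_team_def)
      then have "supports M (misses_inq z x) ?Y"
        using sup Y by (simp add: no_cover_inq_def)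
      then show False
        using assms(1,3) by (auto simp: supports_misses_inq pair_team_def)
    qed
  next
    assume fin: "finite ?A"
    have "supports M (misses_inq z x) Y"
      if Y: "Y \<subseteq> ?X" and "supports M (dep_inq z y x) Y" for Y
    proof (rule ccontr)
      assume "\<not> supports M (misses_inq z x) Y"
      then have onto: "\<exists>g. g \<in> Y \<and> the (g x) = a" if "a \<in> ?A" for a
        using that unfolding supports_misses_inq[OF assms(1)] by blast
      \<comment> \<open>\<open>s\<close> picks an assignment of \<open>Y\<close> for each value of
        \<open>x\<close>. Because \<open>y\<close> determines \<open>x\<close> in \<open>Y\<close>,
        reading off \<open>y\<close> gives an injection of the universe into the universe without
        \<open>c\<close>.\<close>
      define s where "s a = (SOME g. g \<in> Y \<and> the (g x) = a)" for a
      have s: "s a \<in> Y" "the (s a x) = a" if "a \<in> ?A" for a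
        using someI_ex[OF onto[OF that]] by (simp_all add: s_def)
      have "inj_on (\<lambda>a. the (s a y)) ?A"
      proof (rule inj_onI)
        fix a b assume ab: "a \<in> ?A" "b \<in> ?A" "the (s a y) = the (s b y)"
        then have "the (s a x) = the (s b x)" using that(2) s(1) unfolding dep[OF Y] by blast
        then show "a = b" using ab s(2) by simp
      qed
      moreover have "(\<lambda>a. the (s a y)) ` ?A \<subseteq> ?A - {c}"
        using val(2)[OF subsetD[OF Y s(1)]] by auto
      ultimately have "card ?A \<le> card (?A - {c})"
        using fin by (simp add: card_inj_on_le)
      then show False using card_Diff1_less[OF fin c] by linarith
    qed
    then show "supports M (no_cover_inq z x y) ?X"
      by (simp add: no_cover_inq_def)
  qed
qed

section \<open>Ehrenfeucht-Fraisse equivalence of sets with a marked point\<close>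

primrec qdepth :: "('f, 'r) fo \<Rightarrow> nat" where
  "qdepth (FAtom p) = 0"
| "qdepth FBot = 0"
| "qdepth (FAnd \<phi> \<psi>) = max (qdepth \<phi>) (qdepth \<psi>)"
| "qdepth (FOr \<phi> \<psi>) = max (qdepth \<phi>) (qdepth \<psi>)"
| "qdepth (FImp \<phi> \<psi>) = max (qdepth \<phi>) (qdepth \<psi>)"
| "qdepth (FAll v \<phi>) = Suc (qdepth \<phi>)"
| "qdepth (FEx v \<phi>) = Suc (qdepth \<phi>)"

text \<open>An atom \<open>R a b\<close> holds just when \<open>b\<close> differs from
  \<open>c\<close>, so the relation carries no more information than the point
  \<open>c\<close>.\<close>

definition marks :: "'r \<Rightarrow> 'u \<Rightarrow> ('f, 'r, 'u) struct \<Rightarrow> bool" where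
  "marks R c M \<longleftrightarrow> c \<in> universe M \<and>
     rel_interp M R = {[a, b] | a b. a \<in> universe M \<and> b \<in> universe M - {c}}"

text \<open>The values of \<open>g\<close> and \<open>h\<close> on \<open>W\<close> form a partial
  isomorphism of pointed sets. The same \<open>c\<close> serves as the marked point on both
  sides.\<close>

definition matching :: "'u \<Rightarrow> 'u set \<Rightarrow> 'u set \<Rightarrow> var set \<Rightarrow> 'u assignment \<Rightarrow> 'u assignment \<Rightarrow> bool" where
  "matching c A B W g h \<longleftrightarrow> (\<forall>v\<in>W. the (g v) \<in> A \<and> the (h v) \<in> B \<and>
     (the (g v) = c \<longleftrightarrow> the (h v) = c) \<and>
     (\<forall>w\<in>W. the (g v) = the (g w) \<longleftrightarrow> the (h v) = the (h w)))"

lemma matching_sym: "matching c A B W g h \<longleftrightarrow> matching c B A W h g"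
  by (auto simp: matching_def)

text \<open>Answer the marked point by itself and a value already played by its partner; a fresh
  element needs a fresh answer, which the size bound on \<open>B\<close> provides.\<close>

lemma matching_forth:
  assumes m: "matching c A B W g h" and "finite W" "c \<in> B" "d \<in> A"
    and big: "infinite B \<or> Suc (card W) < card B"
  shows "\<exists>e\<in>B. matching c A B (insert v W) (g(v \<mapsto> d)) (h(v \<mapsto> e))"
proof -
  consider "d = c" | w where "w \<in> W" "d = the (g w)" | "d \<noteq> c" "d \<notin> (\<lambda>w. the (g w)) ` W"
    by blast
  then show ?thesis
  proof cases
    case 1
    then show ?thesis
      using m \<open>c \<in> B\<close> \<open>d \<in> A\<close> by (intro bexI[of _ c]) (auto simp: matching_def)
  next
    case (2 w)
    then show ?thesis
      using m by (intro bexI[of _ "the (h w)"]) (auto simp: matching_def)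
  next
    case 3
    \<comment> \<open>The forbidden answers are \<open>c\<close> and the values already used by
      \<open>h\<close>: at most \<open>Suc (card W)\<close> elements, which cannot exhaust
      \<open>B\<close>.\<close>
    let ?F = "insert c ((\<lambda>w. the (h w)) ` W)"
    have "finite ?F" using \<open>finite W\<close> by simp
    moreover have "card ?F \<le> Suc (card W)"
      using card_image_le[OF \<open>finite W\<close>] by (intro card_insert_le_m1) simp_all
    ultimately have "\<not> B \<subseteq> ?F"
      using big card_mono[of ?F B] finite_subset[of B ?F] by linarith
    then obtain e where "e \<in> B" "e \<notin> ?F" by blast
    then show ?thesis
      using m 3 \<open>d \<in> A\<close> by (intro bexI[of _ e]) (auto simp: matching_def)
  qed
qed

text \<open>Without function symbols all terms are variables, so an atom is an equation or
  \<open>R\<close> applied to two variables, and a matching preserves both.\<close>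

lemma atom_true_matching:
  fixes p :: "('f, 'r) atom"
  assumes "marks R c M" "marks R c N" "atom_over (binary_voc R) p" "atom_vars p \<subseteq> W"
    and "matching c (universe M) (universe N) W g h"
  shows "atom_true M g p \<longleftrightarrow> atom_true N h p"
proof -
  have var: "\<exists>v. t = Var v" if "trm_over (binary_voc R :: ('f, 'r) vocabulary) t" for t
    using that by (cases t) (auto simp: binary_voc_def)
  show ?thesis
  proof (cases p)
    case (Eq s t)
    then obtain v w where "s = Var v" "t = Var w"
      using assms(3) var by fastforce
    then show ?thesis using assms(4,5) Eq by (auto simp: matching_def)
  next
    case (Rel r ts)
    then have "r = R" "length ts = 2" and ts: "\<forall>t\<in>set ts. trm_over (binary_voc R :: ('f, 'r) vocabulary) t"
      using assms(3) by (auto simp: binary_voc_def)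
    then obtain s t where "ts = [s, t]"
      by (auto simp: numeral_2_eq_2 length_Suc_conv)
    then obtain v w where "ts = [Var v, Var w]"
      using ts var by fastforce
    then show ?thesis
      using assms(1,2,4,5) Rel \<open>r = R\<close> by (auto simp: matching_def marks_def)
  qed
qed

text \<open>One round of the game. A move in \<open>M\<close> is answered by
  \<open>matching_forth\<close>, a move in \<open>N\<close> by the same lemma with the two sides
  exchanged.\<close>

lemma matching_back_and_forth:
  assumes m: "matching c (universe M) (universe N) W g h" and "finite W"
    and "c \<in> universe M" "c \<in> universe N"
    and "infinite (universe M) \<or> Suc (card W) < card (universe M)"
    and "infinite (universe N) \<or> Suc (card W) < card (universe N)"
    and IH: "\<And>d e. matching c (universe M) (universe N) (insert v W) (g(v \<mapsto> d)) (h(v \<mapsto> e)) \<Longrightarrow>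
      fo_sat M \<phi> (g(v \<mapsto> d)) \<longleftrightarrow> fo_sat N \<phi> (h(v \<mapsto> e))"
  shows "fo_sat M (FAll v \<phi>) g \<longleftrightarrow> fo_sat N (FAll v \<phi>) h"
    and "fo_sat M (FEx v \<phi>) g \<longleftrightarrow> fo_sat N (FEx v \<phi>) h"
proof -
  have forth: "\<exists>e\<in>universe N. fo_sat M \<phi> (g(v \<mapsto> d)) \<longleftrightarrow> fo_sat N \<phi> (h(v \<mapsto> e))"
    if "d \<in> universe M" for d
    using matching_forth[OF m \<open>finite W\<close> assms(4) that assms(6)] IH by blast
  have backward: "\<exists>d\<in>universe M. fo_sat M \<phi> (g(v \<mapsto> d)) \<longleftrightarrow> fo_sat N \<phi> (h(v \<mapsto> e))"
    if e: "e \<in> universe N" for e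
  proof -
    obtain d where d: "d \<in> universe M"
      and m': "matching c (universe N) (universe M) (insert v W) (h(v \<mapsto> e)) (g(v \<mapsto> d))"
      using matching_forth[OF m[THEN matching_sym[THEN iffD1]] \<open>finite W\<close> assms(3) e assms(5)]
      by blast
    show ?thesis using IH[OF m'[THEN matching_sym[THEN iffD1]]] d by blast
  qed
  show "fo_sat M (FAll v \<phi>) g \<longleftrightarrow> fo_sat N (FAll v \<phi>) h"
    and "fo_sat M (FEx v \<phi>) g \<longleftrightarrow> fo_sat N (FEx v \<phi>) h"
    using forth backward by (simp_all, blast+)
qed

text \<open>The bound on \<open>card W + qdepth \<phi>\<close> is the induction invariant: a
  quantifier adds at most one variable to \<open>W\<close> and uses up one level of depth.\<close>

lemma fo_sat_matching:
  assumes "marks R c M" "marks R c N" "finite W"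
    and "fo_over (binary_voc R) \<phi>" "fo_free \<phi> \<subseteq> W"
    and "infinite (universe M) \<or> card W + qdepth \<phi> < card (universe M)"
    and "infinite (universe N) \<or> card W + qdepth \<phi> < card (universe N)"
    and "matching c (universe M) (universe N) W g h"
  shows "fo_sat M \<phi> g \<longleftrightarrow> fo_sat N \<phi> h"
  using assms(3-)
proof (induction \<phi> arbitrary: W g h)
  case (FAtom p)
  then show ?case using atom_true_matching[OF assms(1,2)] by fastforce
next
  case (FAnd \<phi> \<psi>)
  have "fo_sat M \<phi> g \<longleftrightarrow> fo_sat N \<phi> h"
    by (rule FAnd.IH(1)[of W]) (use FAnd.prems in auto)
  moreover have "fo_sat M \<psi> g \<longleftrightarrow> fo_sat N \<psi> h"
    by (rule FAnd.IH(2)[of W]) (use FAnd.prems in auto)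
  ultimately show ?case by simp
next
  case (FOr \<phi> \<psi>)
  have "fo_sat M \<phi> g \<longleftrightarrow> fo_sat N \<phi> h"
    by (rule FOr.IH(1)[of W]) (use FOr.prems in auto)
  moreover have "fo_sat M \<psi> g \<longleftrightarrow> fo_sat N \<psi> h"
    by (rule FOr.IH(2)[of W]) (use FOr.prems in auto)
  ultimately show ?case by simp
next
  case (FImp \<phi> \<psi>)
  have "fo_sat M \<phi> g \<longleftrightarrow> fo_sat N \<phi> h"
    by (rule FImp.IH(1)[of W]) (use FImp.prems in auto)
  moreover have "fo_sat M \<psi> g \<longleftrightarrow> fo_sat N \<psi> h"
    by (rule FImp.IH(2)[of W]) (use FImp.prems in auto)
  ultimately show ?case by simp
next
  case (FAll v \<phi>)
  have card: "card (insert v W) \<le> Suc (card W)" by (rule card_insert_le_m1) simp_all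
  have "fo_sat M \<phi> (g(v \<mapsto> d)) \<longleftrightarrow> fo_sat N \<phi> (h(v \<mapsto> e))"
    if "matching c (universe M) (universe N) (insert v W) (g(v \<mapsto> d)) (h(v \<mapsto> e))" for d e
    by (rule FAll.IH[OF _ _ _ _ _ that]) (use FAll.prems card in auto)
  then show ?case
    using FAll.prems assms(1,2)
    by (intro matching_back_and_forth(1)[of c _ _ W]) (auto simp: marks_def)
next
  case (FEx v \<phi>)
  have card: "card (insert v W) \<le> Suc (card W)" by (rule card_insert_le_m1) simp_all
  have "fo_sat M \<phi> (g(v \<mapsto> d)) \<longleftrightarrow> fo_sat N \<phi> (h(v \<mapsto> e))"
    if "matching c (universe M) (universe N) (insert v W) (g(v \<mapsto> d)) (h(v \<mapsto> e))" for d e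
    by (rule FEx.IH[OF _ _ _ _ _ that]) (use FEx.prems card in auto)
  then show ?case
    using FEx.prems assms(1,2)
    by (intro matching_back_and_forth(2)[of c _ _ W]) (auto simp: marks_def)
qed simp

section \<open>Undefinability by comparing a large finite universe with an infinite one\<close>

theorem theorem2:
  fixes x y :: var and R :: 'r
  assumes "infinite (UNIV :: 'u set)"
    and "x \<noteq> y"
  shows "\<exists>\<phi> :: ('f, 'r) inqbt.
    inqbt_over empty_voc \<phi> \<and> inqbt_free \<phi> = {x, y} \<and>
    \<not> (\<exists>\<phi>' :: ('f, 'r) fo.
        fo_over (binary_voc R) \<phi>' \<and> fo_sentence \<phi>' \<and>
        (\<forall>(M :: ('f, 'r, 'u) struct) X.
           structure_over empty_voc M \<longrightarrow> team_on M {x, y} X \<longrightarrow>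
           (supports M \<phi> X \<longleftrightarrow> fo_true (expand_binary M R (team_rel X x y)) \<phi>')))"
proof -
  \<comment> \<open>A bound variable apart from \<open>x\<close> and \<open>y\<close>, so that
    quantifying over it leaves their values intact.\<close>
  obtain z where z: "z \<noteq> x" "z \<noteq> y"
    using ex_new_if_finite[of "{x, y}"] by auto
  let ?\<phi> = "no_cover_inq z x y :: ('f, 'r) inqbt"
  have False
    if over: "fo_over (binary_voc R) \<phi>'" and sent: "fo_sentence \<phi>'"
      and char: "\<And>(M :: ('f, 'r, 'u) struct) X. structure_over empty_voc M \<Longrightarrow> team_on M {x, y} X \<Longrightarrow>
        supports M ?\<phi> X \<longleftrightarrow> fo_true (expand_binary M R (team_rel X x y)) \<phi>'"
    for \<phi>' :: "('f, 'r) fo"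
  proof -
    \<comment> \<open>The least size allowed by \<open>fo_sat_matching\<close> when no variable has
      been matched yet.\<close>
    obtain A :: "'u set" where A: "finite A" "card A = Suc (qdepth \<phi>')"
      using infinite_arbitrarily_large[OF assms(1)] by blast
    then obtain c where c: "c \<in> A" by fastforce
    \<comment> \<open>The empty vocabulary leaves the interpretations free, and the expansion
      overwrites that of \<open>R\<close>.\<close>
    define S :: "'u set \<Rightarrow> ('f, 'r, 'u) struct"
      where "S B = \<lparr>universe = B, fun_interp = undefined, rel_interp = undefined\<rparr>" for B
    define E where "E B = expand_binary (S B) R (B \<times> (B - {c}))" for B
    have marks: "marks R c (E B)" and univ: "universe (E B) = B" if "c \<in> B" for B
      using that by (auto simp: E_def S_def marks_def expand_binary_def)
    \<comment> \<open>On these teams the supposed translation \<open>\<phi>'\<close> would define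
      finiteness of \<open>B\<close> in the marked structures \<open>E B\<close>.\<close>
    have fin: "finite B \<longleftrightarrow> fo_true (E B) \<phi>'" if "c \<in> B" for B
    proof -
      have "structure_over empty_voc (S B)"
        using that by (auto simp: structure_over_def empty_voc_def S_def)
      moreover have "team_on (S B) {x, y} (pair_team x y (B \<times> (B - {c})))"
        using \<open>x \<noteq> y\<close> by (intro team_on_pair_team) (auto simp: S_def)
      ultimately show ?thesis
        using char supports_no_cover_inq_iff_finite[OF z \<open>x \<noteq> y\<close>, of c "S B"] that \<open>x \<noteq> y\<close>
        by (simp add: team_rel_pair_team E_def S_def)
    qed
    \<comment> \<open>A sentence has no free variables, so the game starts from the empty
      matching.\<close>
    have "fo_true (E A) \<phi>' \<longleftrightarrow> fo_true (E UNIV) \<phi>'"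
      unfolding fo_true_def using over sent A c assms(1)
      by (intro fo_sat_matching[of R c _ _ "{}"])
        (simp_all add: marks univ fo_sentence_def matching_def)
    then show False
      using fin[of A] fin[of UNIV] A c assms(1) by simp
  qed
  moreover have "inqbt_over empty_voc ?\<phi>" "inqbt_free ?\<phi> = {x, y}"
    using z by (auto simp: no_cover_inq_def dep_inq_def const_inq_def misses_inq_def)
  ultimately show ?thesis by blast
qed

end
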